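(* Let $\tau \geq \omega$ be a cardinal and let $Z$ be a $Z_{\tau}$-set in $I^{\tau}$. Suppose also that $Y \subset X$ is a closed subset of a compactum $X$. Then for any map $f \colon X \to I^{\tau}$ and any collection $\{ K_{\alpha} \colon 1\leq \alpha < \tau\}$ of compact subsets of $X$ with $\bigcup_{1\leq \alpha < \tau} K_{\alpha} \cap Y = \emptyset$ there exists a map $g \colon X \to I^{\tau}$ such that $g|Y = f|Y$ and $g\left(\bigcup_{1\leq \alpha < \tau} K_{\alpha}\right) \subset I^{\tau}\setminus Z$.
   Context: A compactum is a compact Hausdorff space (not necessarily metrizable); maps are continuous; $I=[0,1]$. $Z_\tau$-sets: for a Tychonov space $Y$ let $\operatorname{cov}(Y)$ be the collection of all countable covers of $Y$ by functionally open (cozero) sets. Maps $f,g\colon X\to Y$ are ${\mathcal U}$-close if for each $x\in X$ some $U\in{\mathcal U}$ contains both $f(x)$ and $g(x)$. For an infinite cardinal $\tau$, $C_\tau(X,Y)$ is the set of continuous maps $X\to Y$ with the topology in which $G$ is open iff for each $h\in G$ there is a family $\{{\mathcal U}_t\colon t\in T\}\subseteq\operatorname{cov}(Y)$ with $|T|<\tau$ such that every $g$ that is ${\mathcal U}_t$-close to $h$ for all $t\in T$ belongs to $G$. A closed subset $A\subset X$ is a $Z_\tau$-set in $X$ if $\{f\in C_\tau(X,X)\colon f(X)\cap A=\emptyset\}$ is dense in $C_\tau(X,X)$. *)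

theory Defs
  imports "HOL-Analysis.Analysis"
begin

unbundle cardinal_syntax

text \<open>
  Spaces are abstract topologies. A cardinal \<open>\<tau>\<close> is a relation with \<^term>\<open>Card_order \<tau>\<close>, i.e. a
  well-order of minimal order type on \<^term>\<open>Field \<tau>\<close>. Hence \<^term>\<open>Field \<tau>\<close> has cardinality \<open>\<tau>\<close>, and
  its elements, in their order, stand for the ordinals below \<open>\<tau>\<close>.
\<close>

definition Tychonov_cube :: "'i rel \<Rightarrow> ('i \<Rightarrow> real) topology" where
  "Tychonov_cube \<tau> = product_topology (\<lambda>_. top_of_set {0..1}) (Field \<tau>)"

text \<open>The ordinals \<open>\<alpha>\<close> with \<open>1 \<le> \<alpha> < \<tau>\<close>: all elements of \<^term>\<open>Field \<tau>\<close> but the least one.\<close>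

definition nonzero_ordinals_below :: "'i rel \<Rightarrow> 'i set" where
  "nonzero_ordinals_below \<tau> = {\<alpha> \<in> Field \<tau>. underS \<tau> \<alpha> \<noteq> {}}"

definition compactum :: "'a topology \<Rightarrow> bool" where
  "compactum X \<longleftrightarrow> compact_space X \<and> Hausdorff_space X"

definition functionally_open :: "'a topology \<Rightarrow> 'a set \<Rightarrow> bool" where
  "functionally_open Y U \<longleftrightarrow>
     (\<exists>\<phi>. continuous_map Y euclideanreal \<phi> \<and> U = {y \<in> topspace Y. \<phi> y \<noteq> 0})"

definition cov :: "'a topology \<Rightarrow> 'a set set set" where
  "cov Y = {\<U>. countable \<U> \<and> (\<forall>U\<in>\<U>. functionally_open Y U) \<and> \<Union>\<U> = topspace Y}"

definition close_maps ::
  "'a topology \<Rightarrow> 'b set set \<Rightarrow> ('a \<Rightarrow> 'b) \<Rightarrow> ('a \<Rightarrow> 'b) \<Rightarrow> bool" where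
  "close_maps X \<U> f g \<longleftrightarrow> (\<forall>x\<in>topspace X. \<exists>U\<in>\<U>. f x \<in> U \<and> g x \<in> U)"

text \<open>
  Functions are normalised to \<^term>\<open>undefined\<close> outside the space, so that the elements of this set
  correspond one-to-one to the continuous maps \<open>X \<rightarrow> Y\<close>.
\<close>

definition cmaps :: "'a topology \<Rightarrow> 'b topology \<Rightarrow> ('a \<Rightarrow> 'b) set" where
  "cmaps X Y = {f. continuous_map X Y f \<and> f \<in> extensional (topspace X)}"

text \<open>
  The family of covers, of size less than \<open>\<tau>\<close>, is given as a set \<open>\<T>\<close> of covers. The predicate
  describes a topology whenever \<open>\<tau>\<close> is an infinite cardinal, see \<open>istopology_C_tau_open\<close>.
\<close>

definition C_tau_open ::
  "'i rel \<Rightarrow> 'a topology \<Rightarrow> 'b topology \<Rightarrow> ('a \<Rightarrow> 'b) set \<Rightarrow> bool" where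
  "C_tau_open \<tau> X Y G \<longleftrightarrow> G \<subseteq> cmaps X Y \<and>
     (\<forall>h\<in>G. \<exists>\<T>. \<T> \<subseteq> cov Y \<and> |\<T>| <o \<tau> \<and>
        (\<forall>g\<in>cmaps X Y. (\<forall>\<U>\<in>\<T>. close_maps X \<U> g h) \<longrightarrow> g \<in> G))"

definition C_tau :: "'i rel \<Rightarrow> 'a topology \<Rightarrow> 'b topology \<Rightarrow> ('a \<Rightarrow> 'b) topology" where
  "C_tau \<tau> X Y = topology (C_tau_open \<tau> X Y)"

definition Z_tau_set :: "'i rel \<Rightarrow> 'a topology \<Rightarrow> 'a set \<Rightarrow> bool" where
  "Z_tau_set \<tau> X A \<longleftrightarrow> closedin X A \<and>
     C_tau \<tau> X X closure_of {f \<in> cmaps X X. f ` topspace X \<inter> A = {}} = topspace (C_tau \<tau> X X)"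

lemma infinite_Field_if_natLeq_ordLeq:
  assumes "natLeq \<le>o \<tau>"
  shows "infinite (Field \<tau>)"
  using card_of_ordLeq_infinite[OF card_of_mono2[OF assms]] by (simp add: Field_natLeq)

lemma C_tau_openD:
  assumes "C_tau_open \<tau> X Y G" "h \<in> G"
  obtains \<T> where "\<T> \<subseteq> cov Y" "|\<T>| <o \<tau>"
    "\<And>g. g \<in> cmaps X Y \<Longrightarrow> (\<And>\<U>. \<U> \<in> \<T> \<Longrightarrow> close_maps X \<U> g h) \<Longrightarrow> g \<in> G"
  using assms unfolding C_tau_open_def by metis

lemma C_tau_open_subset: "C_tau_open \<tau> X Y G \<Longrightarrow> G \<subseteq> cmaps X Y"
  unfolding C_tau_open_def by (rule conjunct1)

lemma C_tau_openI:
  assumes "G \<subseteq> cmaps X Y"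
    and "\<And>h. h \<in> G \<Longrightarrow> \<exists>\<T>. \<T> \<subseteq> cov Y \<and> |\<T>| <o \<tau> \<and>
        (\<forall>g\<in>cmaps X Y. (\<forall>\<U>\<in>\<T>. close_maps X \<U> g h) \<longrightarrow> g \<in> G)"
  shows "C_tau_open \<tau> X Y G"
  unfolding C_tau_open_def by (intro conjI ballI assms)

lemma istopology_C_tau_open:
  assumes \<tau>: "Card_order \<tau>" "natLeq \<le>o \<tau>"
  shows "istopology (C_tau_open \<tau> X Y)"
  unfolding istopology_def
proof (intro conjI allI impI)
  fix S T
  assume S: "C_tau_open \<tau> X Y S" and T: "C_tau_open \<tau> X Y T"
  show "C_tau_open \<tau> X Y (S \<inter> T)"
  proof (rule C_tau_openI)
    show "S \<inter> T \<subseteq> cmaps X Y" using C_tau_open_subset[OF S] by (rule le_infI1)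
    fix h assume h: "h \<in> S \<inter> T"
    obtain A where A: "A \<subseteq> cov Y" "|A| <o \<tau>"
        "\<And>g. g \<in> cmaps X Y \<Longrightarrow> (\<And>\<U>. \<U> \<in> A \<Longrightarrow> close_maps X \<U> g h) \<Longrightarrow> g \<in> S"
      using C_tau_openD[OF S IntD1[OF h]] by metis
    obtain B where B: "B \<subseteq> cov Y" "|B| <o \<tau>"
        "\<And>g. g \<in> cmaps X Y \<Longrightarrow> (\<And>\<U>. \<U> \<in> B \<Longrightarrow> close_maps X \<U> g h) \<Longrightarrow> g \<in> T"
      using C_tau_openD[OF T IntD2[OF h]] by metis
    show "\<exists>\<T>. \<T> \<subseteq> cov Y \<and> |\<T>| <o \<tau> \<and>
        (\<forall>g\<in>cmaps X Y. (\<forall>\<U>\<in>\<T>. close_maps X \<U> g h) \<longrightarrow> g \<in> S \<inter> T)"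
    proof (intro exI conjI ballI impI)
      show "A \<union> B \<subseteq> cov Y" using A(1) B(1) by (rule Un_least)
      show "|A \<union> B| <o \<tau>"
        by (rule card_of_Un_ordLess_infinite_Field
            [OF infinite_Field_if_natLeq_ordLeq[OF \<tau>(2)] \<tau>(1) A(2) B(2)])
      fix g assume g: "g \<in> cmaps X Y" and close: "\<forall>\<U>\<in>A \<union> B. close_maps X \<U> g h"
      show "g \<in> S \<inter> T" by (intro IntI A(3) B(3) g bspec[OF close] UnI1 UnI2)
    qed
  qed
next
  fix \<G> assume G: "\<forall>G\<in>\<G>. C_tau_open \<tau> X Y G"
  show "C_tau_open \<tau> X Y (\<Union>\<G>)"
  proof (rule C_tau_openI)
    show "\<Union>\<G> \<subseteq> cmaps X Y" by (intro Union_least C_tau_open_subset[of \<tau>] bspec[OF G])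
    fix h assume "h \<in> \<Union>\<G>"
    then obtain G where G': "G \<in> \<G>" "h \<in> G" by (rule UnionE)
    obtain A where A: "A \<subseteq> cov Y" "|A| <o \<tau>"
        "\<And>g. g \<in> cmaps X Y \<Longrightarrow> (\<And>\<U>. \<U> \<in> A \<Longrightarrow> close_maps X \<U> g h) \<Longrightarrow> g \<in> G"
      using C_tau_openD[OF bspec[OF G G'(1)] G'(2)] by metis
    show "\<exists>\<T>. \<T> \<subseteq> cov Y \<and> |\<T>| <o \<tau> \<and>
        (\<forall>g\<in>cmaps X Y. (\<forall>\<U>\<in>\<T>. close_maps X \<U> g h) \<longrightarrow> g \<in> \<Union>\<G>)"
    proof (intro exI conjI ballI impI)
      fix g assume g: "g \<in> cmaps X Y" and close: "\<forall>\<U>\<in>A. close_maps X \<U> g h"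
      show "g \<in> \<Union>\<G>" by (intro UnionI[OF G'(1)] A(3) g bspec[OF close])
    qed (fact A)+
  qed
qed

lemma openin_C_tau:
  assumes "Card_order \<tau>" "natLeq \<le>o \<tau>"
  shows "openin (C_tau \<tau> X Y) G \<longleftrightarrow> C_tau_open \<tau> X Y G"
  unfolding C_tau_def using istopology_C_tau_open[OF assms, of X Y] by (simp only: topology_inverse')

lemma topspace_C_tau:
  fixes Y :: "'b topology"
  assumes "Card_order \<tau>" "natLeq \<le>o \<tau>"
  shows "topspace (C_tau \<tau> X Y) = cmaps X Y"
proof -
  have empty: "|{}::'b set set set| <o \<tau>"
  proof (rule finite_ordLess_infinite[OF card_of_Well_order])
    show "Well_order \<tau>" using assms(1) by (rule card_order_on_well_order_on)
    show "finite (Field |{}::'b set set set| )" unfolding Field_card_of by (rule finite.emptyI)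
    show "infinite (Field \<tau>)" using assms(2) by (rule infinite_Field_if_natLeq_ordLeq)
  qed
  have "C_tau_open \<tau> X Y (cmaps X Y)"
    by (intro C_tau_openI exI[of _ "{}"] conjI ballI impI)
      (rule order_refl empty_subsetI empty | assumption)+
  then show ?thesis
    by (metis C_tau_open_subset openin_C_tau[OF assms] openin_subset openin_topspace subset_antisym)
qed

end

theory Submission
  imports Defs
begin

text \<open>
  The cube \<open>Q = I\<^sup>\<tau>\<close> can be moved off \<open>Z\<close> by maps \<open>r\<close> near the identity, because \<open>Z\<close> is a \<open>Z\<^sub>\<tau>\<close>-set. To
  move a single compact set \<open>K\<close>, disjoint from \<open>Y\<close>, off \<open>Z\<close> under a map \<open>h\<close>, take a Urysohn function \<open>\<phi>\<close>
  which is 0 on \<open>Y\<close> and 1 on \<open>K\<close>, and replace \<open>h\<close> by \<open>(1 - \<phi>) h + \<phi> (r \<circ> h)\<close>. The compact sets are treated one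
  after the other in this way, and the point is that later steps must not undo earlier ones. What
  protects an earlier step is that disjointness of a compact set from \<open>Z\<close> is witnessed by a finite set
  of coordinates and a positive gap in them (\<open>compact_closed_separated_in_cube\<close>). How near to the
  identity \<open>r\<close> can be depends on \<open>\<tau>\<close>, and the two cases differ.

  If \<open>\<tau> = \<omega>\<close>, finitely many coordinates are controlled up to a given positive error
  (\<open>small_move_off_Z_tau_set\<close>). Corrections of geometrically decreasing size converge uniformly in every
  coordinate, and the gaps survive in the limit (\<open>exists_avoiding_map_countable\<close>).

  If \<open>\<tau> > \<omega>\<close>, one can choose \<open>r\<close> to keep any fewer than \<open>\<tau>\<close> coordinates exactly
  (\<open>rigid_move_off_Z_tau_set\<close>). Fewer than \<open>\<tau>\<close> stages, each protecting finitely many coordinates, protect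
  fewer than \<open>\<tau>\<close> of them in total. So each stage can keep all the coordinates protected so far, and
  the map is built coordinate by coordinate in a transfinite recursion of length \<open>\<tau>\<close>
  (\<open>exists_avoiding_map_uncountable\<close>).
\<close>

section \<open>Maps into Tychonov cubes\<close>

lemma topspace_Tychonov_cube:
  "topspace (Tychonov_cube \<tau>) = Field \<tau> \<rightarrow>\<^sub>E {0..1}"
  by (simp add: Tychonov_cube_def)

lemma compact_space_Tychonov_cube: "compact_space (Tychonov_cube \<tau>)"
  by (simp add: Tychonov_cube_def compact_space_product_topology compact_space_subtopology)

lemma continuous_map_into_cubeI:
  assumes "\<And>x. x \<in> topspace X \<Longrightarrow> f x \<in> topspace (Tychonov_cube \<tau>)"
    and "\<And>i. i \<in> Field \<tau> \<Longrightarrow> continuous_map X euclideanreal (\<lambda>x. f x i)"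
  shows "continuous_map X (Tychonov_cube \<tau>) f"
  using assms unfolding Tychonov_cube_def continuous_map_componentwise
  by (fastforce simp: continuous_map_in_subtopology PiE_iff)

lemma continuous_map_into_cube_coordinate:
  assumes "continuous_map X (Tychonov_cube \<tau>) f" "i \<in> Field \<tau>"
  shows "continuous_map X euclideanreal (\<lambda>x. f x i)"
  using assms unfolding Tychonov_cube_def continuous_map_componentwise
  by (simp add: continuous_map_in_subtopology)

lemma continuous_map_cube_coordinate:
  "i \<in> Field \<tau> \<Longrightarrow> continuous_map (Tychonov_cube \<tau>) euclideanreal (\<lambda>y. y i)"
  by (rule continuous_map_into_cube_coordinate[of _ _ "\<lambda>y. y"]) simp_all

lemma continuous_map_into_cube_mem:
  "continuous_map X (Tychonov_cube \<tau>) f \<Longrightarrow> x \<in> topspace X \<Longrightarrow> f x \<in> topspace (Tychonov_cube \<tau>)"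
  by (auto simp: continuous_map_def)

lemma cube_coordinate_bounds:
  "y \<in> topspace (Tychonov_cube \<tau>) \<Longrightarrow> i \<in> Field \<tau> \<Longrightarrow> 0 \<le> y i \<and> y i \<le> 1"
  by (auto simp: topspace_Tychonov_cube PiE_iff)

lemma convex_combination_unit_interval:
  fixes a b t :: real
  assumes "0 \<le> a \<and> a \<le> 1" "0 \<le> b \<and> b \<le> 1" "0 \<le> t \<and> t \<le> 1"
  shows "(1 - t) * a + t * b \<in> {0..1}"
  using convexD_alt[of "{0..1::real}" a b t] assms by simp

text \<open>
  The cube is convex, so two maps into it can be blended with a weight that varies over the domain.
  A map is changed on a compact set and kept on a disjoint closed set by taking a Urysohn function
  as the weight.
\<close>

lemma continuous_map_into_cube_mix:
  assumes "continuous_map X (Tychonov_cube \<tau>) h" "continuous_map X (Tychonov_cube \<tau>) k"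
    and "continuous_map X euclideanreal \<phi>"
    and "\<And>x. x \<in> topspace X \<Longrightarrow> 0 \<le> \<phi> x \<and> \<phi> x \<le> 1"
  shows "continuous_map X (Tychonov_cube \<tau>)
    (\<lambda>x. \<lambda>i\<in>Field \<tau>. (1 - \<phi> x) * h x i + \<phi> x * k x i)"
proof (rule continuous_map_into_cubeI)
  fix x assume x: "x \<in> topspace X"
  have "(1 - \<phi> x) * h x i + \<phi> x * k x i \<in> {0..1}" if "i \<in> Field \<tau>" for i
    using convex_combination_unit_interval
      [OF cube_coordinate_bounds[OF continuous_map_into_cube_mem[OF assms(1) x] that]
        cube_coordinate_bounds[OF continuous_map_into_cube_mem[OF assms(2) x] that] assms(4)[OF x]] .
  then show "(\<lambda>i\<in>Field \<tau>. (1 - \<phi> x) * h x i + \<phi> x * k x i) \<in> topspace (Tychonov_cube \<tau>)"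
    by (simp add: topspace_Tychonov_cube)
next
  fix i assume i: "i \<in> Field \<tau>"
  have "continuous_map X euclideanreal (\<lambda>x. (1 - \<phi> x) * h x i + \<phi> x * k x i)"
    by (intro continuous_map_add continuous_map_real_mult continuous_map_diff assms(3)
        continuous_map_const[THEN iffD2] continuous_map_into_cube_coordinate[OF assms(1) i]
        continuous_map_into_cube_coordinate[OF assms(2) i]) auto
  then show "continuous_map X euclideanreal
      (\<lambda>x. (\<lambda>i\<in>Field \<tau>. (1 - \<phi> x) * h x i + \<phi> x * k x i) i)"
    using i by simp
qed

lemma Urysohn_compactum:
  assumes "compactum X" "closedin X Y" "compactin X K" "K \<inter> Y = {}"
  obtains \<phi> :: "'a \<Rightarrow> real" where "continuous_map X euclideanreal \<phi>"
    "\<And>x. x \<in> topspace X \<Longrightarrow> 0 \<le> \<phi> x \<and> \<phi> x \<le> 1"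
    "\<And>x. x \<in> Y \<Longrightarrow> \<phi> x = 0" "\<And>x. x \<in> K \<Longrightarrow> \<phi> x = 1"
proof -
  have "normal_space X"
    using assms(1) by (simp add: compactum_def compact_Hausdorff_or_regular_imp_normal_space)
  moreover have "closedin X K"
    using assms(1,3) by (simp add: compactum_def compactin_imp_closedin)
  moreover have "disjnt Y K"
    using assms(4) by (auto simp: disjnt_def)
  ultimately obtain \<phi> :: "'a \<Rightarrow> real" where "continuous_map X (top_of_set {0..1}) \<phi>"
    "\<phi> ` Y \<subseteq> {0}" "\<phi> ` K \<subseteq> {1}"
    using Urysohn_lemma[of X Y K 0 1] assms(2) zero_le_one by metis
  then show thesis
    by (intro that[of \<phi>]) (auto simp: continuous_map_in_subtopology image_subset_iff Pi_iff)
qed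

section \<open>Separation by finitely many coordinates\<close>

lemma openin_cube_box:
  assumes "finite E" "E \<subseteq> Field \<tau>"
  shows "openin (Tychonov_cube \<tau>) {y \<in> topspace (Tychonov_cube \<tau>). \<forall>i\<in>E. \<bar>y i - a i\<bar> < \<delta>}"
  using assms
proof induction
  case (insert j E)
  have "openin (Tychonov_cube \<tau>) {y \<in> topspace (Tychonov_cube \<tau>). y j \<in> {a j - \<delta> <..< a j + \<delta>}}"
    using insert.prems
    by (intro openin_continuous_map_preimage[where Y = euclideanreal] continuous_map_cube_coordinate) auto
  then have "openin (Tychonov_cube \<tau>)
      ({y \<in> topspace (Tychonov_cube \<tau>). y j \<in> {a j - \<delta> <..< a j + \<delta>}} \<inter>
       {y \<in> topspace (Tychonov_cube \<tau>). \<forall>i\<in>E. \<bar>y i - a i\<bar> < \<delta>})"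
    using insert by (intro openin_Int) auto
  moreover have "{y \<in> topspace (Tychonov_cube \<tau>). y j \<in> {a j - \<delta> <..< a j + \<delta>}} \<inter>
       {y \<in> topspace (Tychonov_cube \<tau>). \<forall>i\<in>E. \<bar>y i - a i\<bar> < \<delta>} =
       {y \<in> topspace (Tychonov_cube \<tau>). \<forall>i\<in>insert j E. \<bar>y i - a i\<bar> < \<delta>}"
    by (auto simp: abs_less_iff)
  ultimately show ?case by simp
qed auto

lemma closed_set_separated_from_point:
  assumes Z: "closedin (Tychonov_cube \<tau>) Z" and a: "a \<in> topspace (Tychonov_cube \<tau>)" "a \<notin> Z"
  shows "\<exists>E \<delta>. finite E \<and> E \<subseteq> Field \<tau> \<and> \<delta> > 0 \<and> (\<forall>z\<in>Z. \<exists>i\<in>E. \<bar>z i - a i\<bar> \<ge> \<delta>)"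
proof -
  let ?Q = "Tychonov_cube \<tau>"
  have "openin ?Q (topspace ?Q - Z)"
    using Z by blast
  then obtain U where U: "finite {i \<in> Field \<tau>. U i \<noteq> {0..1}}"
      "\<forall>i\<in>Field \<tau>. openin (top_of_set {0..1}) (U i)" "a \<in> Pi\<^sub>E (Field \<tau>) U"
      "Pi\<^sub>E (Field \<tau>) U \<subseteq> topspace ?Q - Z"
    using a unfolding Tychonov_cube_def openin_product_topology_alt topspace_euclidean_subtopology
    by (elim ballE[of _ _ a] exE) blast+
  define E where "E = {i \<in> Field \<tau>. U i \<noteq> {0..1}}"
  have "\<forall>i\<in>E. \<exists>d>0. \<forall>t\<in>{0..1}. \<bar>t - a i\<bar> < d \<longrightarrow> t \<in> U i"
    using U(2,3) unfolding openin_euclidean_subtopology_iff E_def dist_real_def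
    by (auto simp: PiE_iff)
  then obtain d where d: "\<And>i. i \<in> E \<Longrightarrow> d i > (0::real)"
      "\<And>i t. i \<in> E \<Longrightarrow> t \<in> {0..1} \<Longrightarrow> \<bar>t - a i\<bar> < d i \<Longrightarrow> t \<in> U i"
    by metis
  \<comment> \<open>The 1 gives a positive minimum also when \<open>E\<close> is empty.\<close>
  define \<delta> where "\<delta> = Min (insert 1 (d ` E))"
  have fE: "finite E" using U(1) by (simp add: E_def)
  have \<delta>: "\<delta> > 0" "\<And>i. i \<in> E \<Longrightarrow> \<delta> \<le> d i"
    using d(1) fE by (auto simp: \<delta>_def)
  have "\<exists>i\<in>E. \<bar>z i - a i\<bar> \<ge> \<delta>" if z: "z \<in> Z" for z
  proof (rule ccontr)
    assume "\<not> ?thesis"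
    then have *: "\<And>i. i \<in> E \<Longrightarrow> \<bar>z i - a i\<bar> < d i"
      using \<delta>(2) by fastforce
    have zQ: "z \<in> topspace ?Q" using Z z closedin_subset by blast
    have "z i \<in> U i" if "i \<in> Field \<tau>" for i
      using d(2)[OF _ _ *] cube_coordinate_bounds[OF zQ that] that by (cases "i \<in> E") (auto simp: E_def)
    then have "z \<in> Pi\<^sub>E (Field \<tau>) U"
      using zQ by (simp add: topspace_Tychonov_cube PiE_iff)
    then show False using U(4) z by blast
  qed
  then show ?thesis
    using fE \<delta>(1) by (intro exI[of _ E] exI[of _ \<delta>]) (auto simp: E_def)
qed

text \<open>
  Basic neighbourhoods in a product restrict finitely many coordinates, and a compact set is covered
  by finitely many of them. The uniform gap \<open>\<delta>\<close> makes avoidance of \<open>Z\<close> stable under small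
  perturbations of the coordinates in \<open>E\<close>; in particular it is decided by these coordinates alone.
\<close>

lemma compact_closed_separated_in_cube:
  assumes Z: "closedin (Tychonov_cube \<tau>) Z" and A: "compactin (Tychonov_cube \<tau>) A" "A \<inter> Z = {}"
  obtains E \<delta> where "finite E" "E \<subseteq> Field \<tau>" "\<delta> > (0::real)"
    "\<And>a z. a \<in> A \<Longrightarrow> z \<in> Z \<Longrightarrow> \<exists>i\<in>E. \<bar>z i - a i\<bar> \<ge> \<delta>"
proof -
  let ?Q = "Tychonov_cube \<tau>"
  have AQ: "A \<subseteq> topspace ?Q" using A(1) by (rule compactin_subset_topspace)
  then have "\<forall>a\<in>A. \<exists>E \<delta>. finite E \<and> E \<subseteq> Field \<tau> \<and> \<delta> > 0 \<and> (\<forall>z\<in>Z. \<exists>i\<in>E. \<bar>z i - a i\<bar> \<ge> \<delta>)"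
    using closed_set_separated_from_point[OF Z] A(2) by blast
  then obtain E d where E: "\<And>a. a \<in> A \<Longrightarrow> finite (E a)" "\<And>a. a \<in> A \<Longrightarrow> E a \<subseteq> Field \<tau>"
      "\<And>a. a \<in> A \<Longrightarrow> d a > (0::real)"
      "\<And>a z. a \<in> A \<Longrightarrow> z \<in> Z \<Longrightarrow> \<exists>i\<in>E a. \<bar>z i - a i\<bar> \<ge> d a"
    by metis
  \<comment> \<open>Half of the radius covers \<open>A\<close>, and the triangle inequality leaves the other half as the gap.\<close>
  define B where "B a = {y \<in> topspace ?Q. \<forall>i\<in>E a. \<bar>y i - a i\<bar> < d a / 2}" for a
  have "\<forall>U\<in>B ` A. openin ?Q U"
    using openin_cube_box E(1,2) unfolding B_def by blast
  moreover have "A \<subseteq> \<Union>(B ` A)"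
    using AQ E(3) by (fastforce simp: B_def)
  ultimately obtain \<F> where "finite \<F>" "\<F> \<subseteq> B ` A" "A \<subseteq> \<Union>\<F>"
    using A(1) unfolding compactin_def by meson
  then obtain A' where A': "finite A'" "A' \<subseteq> A" "A \<subseteq> \<Union>(B ` A')"
    by (metis finite_subset_image)
  define \<delta> where "\<delta> = Min (insert 1 ((\<lambda>a. d a / 2) ` A'))"
  have \<delta>: "\<delta> > 0" "\<And>a. a \<in> A' \<Longrightarrow> \<delta> \<le> d a / 2"
    using E(3) A'(1,2) unfolding \<delta>_def by (fastforce, intro Min_le, auto)
  show thesis
  proof (rule that[of "\<Union>(E ` A')" \<delta>])
    fix a z assume "a \<in> A" "z \<in> Z"
    then obtain c where c: "c \<in> A'" "a \<in> B c" using A'(3) by blast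
    then obtain i where i: "i \<in> E c" "\<bar>z i - c i\<bar> \<ge> d c"
      using E(4) \<open>z \<in> Z\<close> A'(2) by blast
    then have "\<bar>a i - c i\<bar> < d c / 2" using c(2) by (simp add: B_def)
    then have "\<bar>z i - a i\<bar> \<ge> \<delta>" using i(2) \<delta>(2)[OF c(1)] by linarith
    then show "\<exists>i\<in>\<Union>(E ` A'). \<bar>z i - a i\<bar> \<ge> \<delta>" using c(1) i(1) by blast
  next
    show "finite (\<Union>(E ` A'))" "\<Union>(E ` A') \<subseteq> Field \<tau>"
      using E(1,2) A'(1,2) by blast+
  qed (rule \<delta>(1))
qed

section \<open>Moving the cube off a \<open>Z\<^sub>\<tau>\<close>-set\<close>

text \<open>
  Countable functionally open covers through which the neighbourhoods of a map in \<open>C\<^sub>\<tau>\<close> control one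
  coordinate: maps that are close for such a cover differ by less than \<open>2 * \<eta>\<close> in coordinate \<open>i\<close>.
  Rational centres keep the cover countable.
\<close>

definition coordinate_cover :: "'i rel \<Rightarrow> 'i \<Rightarrow> real \<Rightarrow> ('i \<Rightarrow> real) set set" where
  "coordinate_cover \<tau> i \<eta> = (\<lambda>q. {y \<in> topspace (Tychonov_cube \<tau>). \<bar>y i - q\<bar> < \<eta>}) ` \<rat>"

lemma coordinate_cover_in_cov:
  assumes "i \<in> Field \<tau>" "\<eta> > 0"
  shows "coordinate_cover \<tau> i \<eta> \<in> cov (Tychonov_cube \<tau>)"
  unfolding cov_def mem_Collect_eq
proof (intro conjI ballI)
  show "countable (coordinate_cover \<tau> i \<eta>)"
    by (simp add: coordinate_cover_def countable_rat)
next
  fix U assume "U \<in> coordinate_cover \<tau> i \<eta>"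
  then obtain q where q: "U = {y \<in> topspace (Tychonov_cube \<tau>). \<bar>y i - q\<bar> < \<eta>}"
    by (auto simp: coordinate_cover_def)
  show "functionally_open (Tychonov_cube \<tau>) U"
    unfolding functionally_open_def
  proof (intro exI conjI)
    show "continuous_map (Tychonov_cube \<tau>) euclideanreal (\<lambda>y. max 0 (\<eta> - \<bar>y i - q\<bar>))"
      by (intro continuous_map_real_max continuous_map_diff continuous_map_real_abs
          continuous_map_const[THEN iffD2] continuous_map_cube_coordinate assms) auto
    show "U = {y \<in> topspace (Tychonov_cube \<tau>). max 0 (\<eta> - \<bar>y i - q\<bar>) \<noteq> 0}"
      unfolding q by (auto simp: max_def)
  qed
next
  have "\<exists>q\<in>\<rat>. \<bar>t - q\<bar> < \<eta>" for t :: real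
  proof -
    obtain q where "q \<in> \<rat>" "t - \<eta> < q" "q < t + \<eta>"
      using Rats_dense_in_real[of "t - \<eta>" "t + \<eta>"] assms(2) by auto
    then show ?thesis by (intro bexI[of _ q]) auto
  qed
  then show "\<Union>(coordinate_cover \<tau> i \<eta>) = topspace (Tychonov_cube \<tau>)"
    by (auto simp: coordinate_cover_def)
qed

lemma close_maps_coordinate_cover:
  assumes "close_maps X (coordinate_cover \<tau> i \<eta>) g h" "x \<in> topspace X"
  shows "\<bar>g x i - h x i\<bar> < 2 * \<eta>"
proof -
  obtain q where "\<bar>g x i - q\<bar> < \<eta>" "\<bar>h x i - q\<bar> < \<eta>"
    using assms by (fastforce simp: close_maps_def coordinate_cover_def)
  then show ?thesis by linarith
qed

lemma Z_tau_set_meets_open: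
  assumes \<tau>: "Card_order \<tau>" "natLeq \<le>o \<tau>" and Z: "Z_tau_set \<tau> X Z"
    and G: "C_tau_open \<tau> X X G" "h \<in> G"
  obtains r where "r \<in> G" "continuous_map X X r" "r ` topspace X \<inter> Z = {}"
proof -
  have "h \<in> C_tau \<tau> X X closure_of {f \<in> cmaps X X. f ` topspace X \<inter> Z = {}}"
    using Z G(2) C_tau_open_subset[OF G(1)] by (auto simp: Z_tau_set_def topspace_C_tau[OF \<tau>])
  then obtain r where "r \<in> {f \<in> cmaps X X. f ` topspace X \<inter> Z = {}}" "r \<in> G"
    using G openin_C_tau[OF \<tau>, of X X G] by (auto simp: in_closure_of)
  then show thesis by (intro that[of r]) (auto simp: cmaps_def)
qed

lemma restrict_id_in_cmaps: "restrict id (topspace X) \<in> cmaps X X"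
proof -
  have "continuous_map X X (restrict id (topspace X))"
    by (rule continuous_map_eq[OF continuous_map_id]) simp
  then show ?thesis by (simp add: cmaps_def)
qed

text \<open>
  Finitely many covers are allowed for every infinite \<open>\<tau>\<close>, and they suffice to control finitely many
  coordinates up to \<open>\<delta>\<close>.
\<close>

lemma small_move_off_Z_tau_set:
  assumes \<tau>: "Card_order \<tau>" "natLeq \<le>o \<tau>" and Z: "Z_tau_set \<tau> (Tychonov_cube \<tau>) Z"
    and E: "finite E" "E \<subseteq> Field \<tau>" and \<delta>: "\<delta> > 0"
  obtains r where "continuous_map (Tychonov_cube \<tau>) (Tychonov_cube \<tau>) r"
    "r ` topspace (Tychonov_cube \<tau>) \<inter> Z = {}"
    "\<And>y i. y \<in> topspace (Tychonov_cube \<tau>) \<Longrightarrow> i \<in> E \<Longrightarrow> \<bar>r y i - y i\<bar> < \<delta>"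
proof -
  let ?Q = "Tychonov_cube \<tau>"
  \<comment> \<open>A bound \<open>\<eta> < \<delta>\<close> that is uniform in \<open>y\<close> is what makes this set open: \<open>\<delta> - \<eta>\<close> is room for covers.\<close>
  define G where "G = {g \<in> cmaps ?Q ?Q. \<exists>\<eta><\<delta>. \<forall>y\<in>topspace ?Q. \<forall>i\<in>E. \<bar>g y i - y i\<bar> \<le> \<eta>}"
  have "C_tau_open \<tau> ?Q ?Q G"
  proof (rule C_tau_openI)
    fix h assume "h \<in> G"
    then obtain \<eta> where \<eta>: "\<eta> < \<delta>" "\<And>y i. y \<in> topspace ?Q \<Longrightarrow> i \<in> E \<Longrightarrow> \<bar>h y i - y i\<bar> \<le> \<eta>"
      by (auto simp: G_def)
    define \<T> where "\<T> = (\<lambda>i. coordinate_cover \<tau> i ((\<delta> - \<eta>) / 4)) ` E"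
    have "\<T> \<subseteq> cov ?Q"
      using coordinate_cover_in_cov E(2) \<eta>(1) unfolding \<T>_def by fastforce
    moreover have "|\<T>| <o \<tau>"
      using E(1) finite_iff_ordLess_natLeq[of \<T>] ordLess_ordLeq_trans[OF _ \<tau>(2)]
      by (auto simp: \<T>_def)
    moreover have "g \<in> G" if g: "g \<in> cmaps ?Q ?Q" "\<forall>\<U>\<in>\<T>. close_maps ?Q \<U> g h" for g
    proof -
      have "\<bar>g y i - y i\<bar> \<le> (\<delta> + \<eta>) / 2" if "y \<in> topspace ?Q" "i \<in> E" for y i
      proof -
        have "\<bar>g y i - h y i\<bar> < 2 * ((\<delta> - \<eta>) / 4)"
          using g(2) that by (intro close_maps_coordinate_cover[of ?Q \<tau>]) (auto simp: \<T>_def)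
        then show ?thesis using \<eta>(2)[OF that] by argo
      qed
      moreover have "(\<delta> + \<eta>) / 2 < \<delta>" using \<eta>(1) by simp
      ultimately show ?thesis using g(1) unfolding G_def by blast
    qed
    ultimately show "\<exists>\<T>\<subseteq>cov ?Q. |\<T>| <o \<tau> \<and>
        (\<forall>g\<in>cmaps ?Q ?Q. (\<forall>\<U>\<in>\<T>. close_maps ?Q \<U> g h) \<longrightarrow> g \<in> G)"
      by blast
  qed (auto simp: G_def)
  moreover have "restrict id (topspace ?Q) \<in> G"
    using restrict_id_in_cmaps[of ?Q] \<delta> by (auto simp: G_def intro!: exI[of _ 0])
  ultimately obtain r where "r \<in> G" "continuous_map ?Q ?Q r" "r ` topspace ?Q \<inter> Z = {}"
    using Z_tau_set_meets_open[OF \<tau> Z] by blast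
  then show thesis
    by (intro that[of r]) (fastforce simp: G_def)+
qed

lemma card_UN_countable_less:
  assumes "Card_order \<tau>" "natLeq <o \<tau>" "|I| <o \<tau>" "\<And>i. i \<in> I \<Longrightarrow> countable (A i)"
  shows "|\<Union>i\<in>I. A i| <o \<tau>"
proof -
  let ?r = "|I <+> (UNIV :: nat set)|"
  have nat: "|UNIV :: nat set| <o \<tau>"
    using card_of_nat assms(2) by (rule ordIso_ordLess_trans)
  have "|\<Union>i\<in>I. A i| \<le>o ?r"
  proof (rule card_of_UNION_ordLeq_infinite_Field)
    show "infinite (Field ?r)" by (simp add: Field_card_of)
    show "|I| \<le>o ?r" by (rule card_of_Plus1)
    show "\<forall>i\<in>I. |A i| \<le>o ?r"
    proof
      fix i assume "i \<in> I"
      then have "|A i| \<le>o |UNIV :: nat set|"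
        using assms(4) card_of_ordLeq[of "A i" "UNIV :: nat set"] by (auto simp: countable_def)
      then show "|A i| \<le>o ?r" using card_of_Plus2 ordLeq_transitive by blast
    qed
  qed (rule card_of_Card_order)
  also have "?r <o \<tau>"
    using infinite_Field_if_natLeq_ordLeq[OF ordLess_imp_ordLeq[OF assms(2)]] assms(1,3) nat
    by (rule card_of_Plus_ordLess_infinite_Field)
  finally show ?thesis .
qed

text \<open>
  For uncountable \<open>\<tau>\<close> one may use, for each of fewer than \<open>\<tau>\<close> coordinates, a whole sequence of covers
  of mesh tending to 0. Maps close for all of them agree exactly in these coordinates, so the maps that
  keep the coordinates in \<open>F\<close> form an open set. For \<open>\<tau> = \<omega>\<close> this fails: the face of the cube where one
  coordinate vanishes is a \<open>Z\<close>-set, and no map keeping that coordinate avoids it.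
\<close>

lemma rigid_move_off_Z_tau_set:
  assumes \<tau>: "Card_order \<tau>" "natLeq <o \<tau>" and Z: "Z_tau_set \<tau> (Tychonov_cube \<tau>) Z"
    and F: "F \<subseteq> Field \<tau>" "|F| <o \<tau>"
  obtains r where "continuous_map (Tychonov_cube \<tau>) (Tychonov_cube \<tau>) r"
    "r ` topspace (Tychonov_cube \<tau>) \<inter> Z = {}"
    "\<And>y i. y \<in> topspace (Tychonov_cube \<tau>) \<Longrightarrow> i \<in> F \<Longrightarrow> r y i = y i"
proof -
  let ?Q = "Tychonov_cube \<tau>"
  have \<tau>': "natLeq \<le>o \<tau>" using \<tau>(2) by (rule ordLess_imp_ordLeq)
  define G where "G = {g \<in> cmaps ?Q ?Q. \<forall>y\<in>topspace ?Q. \<forall>i\<in>F. g y i = y i}"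
  define \<T> where "\<T> = (\<Union>i\<in>F. range (\<lambda>n. coordinate_cover \<tau> i (inverse (real (Suc n)))))"
  have "C_tau_open \<tau> ?Q ?Q G"
  proof (rule C_tau_openI)
    fix h assume h: "h \<in> G"
    have "\<T> \<subseteq> cov ?Q"
      using coordinate_cover_in_cov F(1) unfolding \<T>_def by fastforce
    moreover have "|\<T>| <o \<tau>"
      unfolding \<T>_def by (rule card_UN_countable_less[OF \<tau> F(2)]) simp
    moreover have "g \<in> G" if g: "g \<in> cmaps ?Q ?Q" "\<forall>\<U>\<in>\<T>. close_maps ?Q \<U> g h" for g
    proof -
      have "g y i = y i" if yi: "y \<in> topspace ?Q" "i \<in> F" for y i
      proof (rule ccontr)
        assume "g y i \<noteq> y i"
        then obtain n where n: "inverse (real (Suc n)) < \<bar>g y i - y i\<bar> / 2"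
          using reals_Archimedean[of "\<bar>g y i - y i\<bar> / 2"] by auto
        have "\<bar>g y i - h y i\<bar> < 2 * inverse (real (Suc n))"
          using g(2) yi by (intro close_maps_coordinate_cover[of ?Q \<tau>]) (auto simp: \<T>_def)
        moreover have "h y i = y i" using h yi by (simp add: G_def)
        ultimately show False using n by simp
      qed
      then show ?thesis using g(1) by (simp add: G_def)
    qed
    ultimately show "\<exists>\<T>\<subseteq>cov ?Q. |\<T>| <o \<tau> \<and>
        (\<forall>g\<in>cmaps ?Q ?Q. (\<forall>\<U>\<in>\<T>. close_maps ?Q \<U> g h) \<longrightarrow> g \<in> G)"
      by blast
  qed (auto simp: G_def)
  moreover have "restrict id (topspace ?Q) \<in> G"
    using restrict_id_in_cmaps[of ?Q] by (auto simp: G_def)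
  ultimately obtain r where "r \<in> G" "continuous_map ?Q ?Q r" "r ` topspace ?Q \<inter> Z = {}"
    using Z_tau_set_meets_open[OF \<tau>(1) \<tau>' Z] by blast
  then show thesis
    by (intro that[of r]) (auto simp: G_def)
qed

section \<open>Countably many compact sets\<close>

text \<open>
  Blend \<open>h\<close> with its composition with a small move \<open>r\<close> of the cube off \<open>Z\<close>, with weight 0 on \<open>Y\<close> and 1 on
  \<open>K\<close>.
\<close>

lemma push_compact_off:
  fixes X :: "'a topology"
  assumes \<tau>: "Card_order \<tau>" "natLeq \<le>o \<tau>" and Z: "Z_tau_set \<tau> (Tychonov_cube \<tau>) Z"
    and X: "compactum X" "closedin X Y" and h: "continuous_map X (Tychonov_cube \<tau>) h"
    and K: "compactin X K" "K \<inter> Y = {}"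
    and E: "finite E" "E \<subseteq> Field \<tau>" "\<delta> > 0"
  obtains h' where "continuous_map X (Tychonov_cube \<tau>) h'" "\<And>y. y \<in> Y \<Longrightarrow> h' y = h y"
    "\<And>x i. x \<in> topspace X \<Longrightarrow> i \<in> E \<Longrightarrow> \<bar>h' x i - h x i\<bar> \<le> \<delta>" "h' ` K \<inter> Z = {}"
proof -
  let ?Q = "Tychonov_cube \<tau>"
  obtain r where r: "continuous_map ?Q ?Q r" "r ` topspace ?Q \<inter> Z = {}"
    "\<And>y i. y \<in> topspace ?Q \<Longrightarrow> i \<in> E \<Longrightarrow> \<bar>r y i - y i\<bar> < \<delta>"
    using small_move_off_Z_tau_set[OF \<tau> Z E] by blast
  obtain \<phi> :: "'a \<Rightarrow> real" where \<phi>: "continuous_map X euclideanreal \<phi>"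
    "\<And>x. x \<in> topspace X \<Longrightarrow> 0 \<le> \<phi> x \<and> \<phi> x \<le> 1"
    "\<And>x. x \<in> Y \<Longrightarrow> \<phi> x = 0" "\<And>x. x \<in> K \<Longrightarrow> \<phi> x = 1"
    using Urysohn_compactum[OF X K] by blast
  have rh: "continuous_map X ?Q (\<lambda>x. r (h x))"
    using continuous_map_compose[OF h r(1)] by (simp add: o_def)
  define h' where "h' x = (\<lambda>i\<in>Field \<tau>. (1 - \<phi> x) * h x i + \<phi> x * r (h x) i)" for x
  have hQ: "h x \<in> topspace ?Q" "r (h x) \<in> topspace ?Q" if "x \<in> topspace X" for x
    using that h rh by (auto intro: continuous_map_into_cube_mem)
  show thesis
  proof (rule that[of h'])
    show "continuous_map X ?Q h'"
      unfolding h'_def by (rule continuous_map_into_cube_mix[OF h rh \<phi>(1,2)])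
    show "h' y = h y" if "y \<in> Y" for y
      using hQ(1)[of y] \<phi>(3)[OF that] that closedin_subset[OF X(2)]
      by (auto simp: h'_def topspace_Tychonov_cube PiE_iff extensional_def fun_eq_iff)
    show "\<bar>h' x i - h x i\<bar> \<le> \<delta>" if "x \<in> topspace X" "i \<in> E" for x i
    proof -
      have "i \<in> Field \<tau>" using that(2) E(2) by (rule rev_subsetD)
      then have "h' x i - h x i = \<phi> x * (r (h x) i - h x i)"
        by (simp add: h'_def algebra_simps)
      then have "\<bar>h' x i - h x i\<bar> = \<phi> x * \<bar>r (h x) i - h x i\<bar>"
        using \<phi>(2)[OF that(1)] by (simp add: abs_mult)
      also have "\<dots> \<le> 1 * \<delta>"
        using \<phi>(2)[OF that(1)] r(3)[OF hQ(1)[OF that(1)] that(2)] by (intro mult_mono) auto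
      finally show ?thesis by simp
    qed
    show "h' ` K \<inter> Z = {}"
    proof -
      have "h' x \<in> r ` topspace ?Q" if "x \<in> K" for x
      proof -
        have "x \<in> topspace X" using that compactin_subset_topspace[OF K(1)] by (rule rev_subsetD)
        note hx = hQ[OF this]
        have "h' x = r (h x)"
          using hx(2) \<phi>(4)[OF that]
          by (simp add: h'_def topspace_Tychonov_cube PiE_iff extensional_restrict)
        then show ?thesis using hx(1) by simp
      qed
      then show ?thesis using r(2) by blast
    qed
  qed
qed

text \<open>
  The inductive step for countable weight. Any map within \<open>\<delta>'\<close> of \<open>h'\<close> in the coordinates \<open>E'\<close> still
  sends \<open>K\<close> off \<open>Z\<close>, so later corrections cannot spoil this if their total size stays below \<open>\<delta>'\<close>.
\<close>

lemma push_compact_off_stably: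
  assumes \<tau>: "Card_order \<tau>" "natLeq \<le>o \<tau>" and Z: "Z_tau_set \<tau> (Tychonov_cube \<tau>) Z"
    and X: "compactum X" "closedin X Y" and h: "continuous_map X (Tychonov_cube \<tau>) h"
    and K: "compactin X K" "K \<inter> Y = {}"
    and E: "finite E" "E \<subseteq> Field \<tau>" "\<delta> > 0" and j: "j \<in> Field \<tau>"
  shows "\<exists>h' E' \<delta>'. continuous_map X (Tychonov_cube \<tau>) h' \<and> (\<forall>y\<in>Y. h' y = h y) \<and>
    finite E' \<and> E' \<subseteq> Field \<tau> \<and> E \<subseteq> E' \<and> j \<in> E' \<and> 0 < \<delta>' \<and> \<delta>' \<le> \<delta> / 2 \<and>
    (\<forall>x\<in>topspace X. \<forall>i\<in>E. \<bar>h' x i - h x i\<bar> \<le> \<delta> / 2) \<and>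
    (\<forall>x\<in>K. \<forall>z\<in>Z. \<exists>i\<in>E'. \<delta>' < \<bar>z i - h' x i\<bar>)"
proof -
  have "\<delta> / 2 > 0" using E(3) by simp
  then obtain h' where h': "continuous_map X (Tychonov_cube \<tau>) h'" "\<And>y. y \<in> Y \<Longrightarrow> h' y = h y"
    "\<And>x i. x \<in> topspace X \<Longrightarrow> i \<in> E \<Longrightarrow> \<bar>h' x i - h x i\<bar> \<le> \<delta> / 2" "h' ` K \<inter> Z = {}"
    using push_compact_off[OF \<tau> Z X h K E(1,2)] by blast
  have "closedin (Tychonov_cube \<tau>) Z"
    using Z by (simp add: Z_tau_set_def)
  then obtain D d where D: "finite D" "D \<subseteq> Field \<tau>" "d > 0"
    "\<And>a z. a \<in> h' ` K \<Longrightarrow> z \<in> Z \<Longrightarrow> \<exists>i\<in>D. \<bar>z i - a i\<bar> \<ge> (d :: real)"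
    by (rule compact_closed_separated_in_cube[OF _ image_compactin[OF K(1) h'(1)] h'(4)]) (rule that)
  have "\<exists>i\<in>insert j (E \<union> D). min (\<delta> / 2) (d / 2) < \<bar>z i - h' x i\<bar>" if x: "x \<in> K" and z: "z \<in> Z" for x z
  proof -
    obtain i where "i \<in> D" "\<bar>z i - h' x i\<bar> \<ge> d"
      using D(4)[OF imageI[OF x] z] by blast
    moreover have "min (\<delta> / 2) (d / 2) < d" using D(3) by simp
    ultimately show ?thesis by (intro bexI[of _ i]) auto
  qed
  moreover have "E \<subseteq> insert j (E \<union> D)" "min (\<delta> / 2) (d / 2) \<le> \<delta> / 2" by auto
  ultimately show ?thesis
    using h'(1-3) D(1-3) E j
    by (intro exI[of _ h'] exI[of _ "insert j (E \<union> D)"] exI[of _ "min (\<delta> / 2) (d / 2)"]) simp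
qed

text \<open>
  Maps \<open>h n\<close> are corrected on one \<open>L n\<close> after the other. The \<open>n\<close>-th correction is at most \<open>\<delta> n / 2\<close> in the
  coordinates of \<open>E n\<close>, while \<open>\<delta>\<close> is at least halved in each step; hence all corrections from the \<open>n\<close>-th
  on add up to at most \<open>\<delta> n\<close> in these coordinates. As the sets \<open>E n\<close> increase to the whole index set, the
  maps converge uniformly in each coordinate, and the limit inherits the avoidance won at every stage.
\<close>

lemma exists_avoiding_map_countable:
  fixes f :: "'a \<Rightarrow> 'i \<Rightarrow> real" and L :: "nat \<Rightarrow> 'a set" and e :: "nat \<Rightarrow> 'i"
  assumes \<tau>: "Card_order \<tau>" "natLeq \<le>o \<tau>" and Z: "Z_tau_set \<tau> (Tychonov_cube \<tau>) Z"
    and X: "compactum X" "closedin X Y" and f: "continuous_map X (Tychonov_cube \<tau>) f"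
    and L: "\<And>n. compactin X (L n)" "\<And>n. L n \<inter> Y = {}"
    and e: "range e = Field \<tau>"
  obtains g where "continuous_map X (Tychonov_cube \<tau>) g" "\<And>y. y \<in> Y \<Longrightarrow> g y = f y"
    "\<And>n x. x \<in> L n \<Longrightarrow> g x \<notin> Z"
proof -
  let ?Q = "Tychonov_cube \<tau>"
  have YX: "Y \<subseteq> topspace X" using X(2) by (rule closedin_subset)
  have LX: "L n \<subseteq> topspace X" for n using L(1) by (rule compactin_subset_topspace)
  define P where "P = (\<lambda>(n::nat) (h, E, \<delta>). continuous_map X ?Q h \<and> (\<forall>y\<in>Y. h y = f y) \<and>
    finite E \<and> E \<subseteq> Field \<tau> \<and> 0 < (\<delta>::real))"
  define S where "S = (\<lambda>n (h, E, \<delta>::real) (h', E', \<delta>'). E \<subseteq> E' \<and> e n \<in> E' \<and> \<delta>' \<le> \<delta> / 2 \<and>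
    (\<forall>x\<in>topspace X. \<forall>i\<in>E. \<bar>h' x i - h x i\<bar> \<le> \<delta> / 2) \<and>
    (\<forall>x\<in>L n. \<forall>z\<in>Z. \<exists>i\<in>E'. \<delta>' < \<bar>z i - h' x i\<bar>))"
  have "\<exists>F. \<forall>n. P n (F n) \<and> S n (F n) (F (Suc n))"
  proof (rule dependent_nat_choice)
    show "\<exists>p. P 0 p"
      using f by (intro exI[of _ "(f, {}, 1)"]) (simp add: P_def)
  next
    fix p n assume "P n p"
    obtain h E \<delta> where p: "p = (h, E, \<delta>)" by (cases p)
    have h: "continuous_map X ?Q h" "\<forall>y\<in>Y. h y = f y" and E: "finite E" "E \<subseteq> Field \<tau>" "0 < \<delta>"
      using \<open>P n p\<close> by (auto simp: P_def p)
    have "e n \<in> Field \<tau>" using e by blast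
    from push_compact_off_stably[OF \<tau> Z X h(1) L(1)[of n] L(2)[of n] E this]
    obtain h' E' \<delta>' where "continuous_map X ?Q h' \<and> (\<forall>y\<in>Y. h' y = h y) \<and>
        finite E' \<and> E' \<subseteq> Field \<tau> \<and> E \<subseteq> E' \<and> e n \<in> E' \<and> 0 < \<delta>' \<and> \<delta>' \<le> \<delta> / 2 \<and>
        (\<forall>x\<in>topspace X. \<forall>i\<in>E. \<bar>h' x i - h x i\<bar> \<le> \<delta> / 2) \<and>
        (\<forall>x\<in>L n. \<forall>z\<in>Z. \<exists>i\<in>E'. \<delta>' < \<bar>z i - h' x i\<bar>)"
      by (elim exE) (rule that)
    then show "\<exists>p'. P (Suc n) p' \<and> S n p p'"
      using h(2) by (intro exI[of _ "(h', E', \<delta>')"]) (simp add: P_def S_def p)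
  qed
  then obtain F where F: "\<And>n. P n (F n)" "\<And>n. S n (F n) (F (Suc n))" by blast
  define h E \<delta> where "h n = fst (F n)" and "E n = fst (snd (F n))" and "\<delta> n = snd (snd (F n))" for n
  have h: "continuous_map X ?Q (h n)" "\<And>y. y \<in> Y \<Longrightarrow> h n y = f y" and "E n \<subseteq> Field \<tau>"
    and \<delta>_pos: "\<delta> n > 0" for n
    using F(1)[of n] by (auto simp: P_def h_def E_def \<delta>_def split_beta)
  have E_Suc: "E n \<subseteq> E (Suc n)" and e_in: "e n \<in> E (Suc n)" and \<delta>_Suc: "\<delta> (Suc n) \<le> \<delta> n / 2"
    and step: "\<And>x i. x \<in> topspace X \<Longrightarrow> i \<in> E n \<Longrightarrow> \<bar>h (Suc n) x i - h n x i\<bar> \<le> \<delta> n / 2"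
    and away: "\<And>x z. x \<in> L n \<Longrightarrow> z \<in> Z \<Longrightarrow> \<exists>i\<in>E (Suc n). \<delta> (Suc n) < \<bar>z i - h (Suc n) x i\<bar>" for n
    using F(2)[of n] by (auto simp: S_def h_def E_def \<delta>_def split_beta)
  have E_mono: "E n \<subseteq> E m" if "n \<le> m" for n m
    using lift_Suc_mono_le[of E, OF E_Suc that] .
  have telescope: "\<bar>h m x i - h n x i\<bar> \<le> \<delta> n - \<delta> m"
    if "n \<le> m" "x \<in> topspace X" "i \<in> E n" for n m x i
    using that(1)
  proof (induction rule: dec_induct)
    case (step k)
    have "i \<in> E k" using E_mono[OF step(1)] that(3) by blast
    then have "\<bar>h (Suc k) x i - h k x i\<bar> \<le> \<delta> k / 2"
      using \<open>\<And>n x i. x \<in> topspace X \<Longrightarrow> i \<in> E n \<Longrightarrow> \<bar>h (Suc n) x i - h n x i\<bar> \<le> \<delta> n / 2\<close> that(2) by blast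
    then show ?case using step.IH \<delta>_Suc[of k] by linarith
  qed simp
  have \<delta>_geometric: "\<delta> n \<le> \<delta> 0 * (1 / 2) ^ n" for n
  proof (induction n)
    case (Suc n)
    then show ?case using \<delta>_Suc[of n] by simp
  qed simp
  have "(\<lambda>n. \<delta> 0 * (1 / 2) ^ n) \<longlonglongrightarrow> \<delta> 0 * 0"
    by (intro tendsto_intros LIMSEQ_realpow_zero) auto
  then have \<delta>_lim: "\<delta> \<longlonglongrightarrow> 0"
    using \<delta>_geometric \<delta>_pos[THEN less_imp_le]
    by (intro tendsto_sandwich[of "\<lambda>_. 0" \<delta> sequentially "\<lambda>n. \<delta> 0 * (1 / 2) ^ n"]) auto
  have "\<exists>G. continuous_map X euclideanreal G \<and> (\<forall>x\<in>topspace X. (\<lambda>n. h n x i) \<longlonglongrightarrow> G x)"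
    if i: "i \<in> Field \<tau>" for i
  proof -
    obtain k where "i = e k" using e i by blast
    then have iE: "i \<in> E (Suc k)" using e_in by simp
    obtain G where "continuous_map X Met_TC.mtopology G"
      and G: "\<And>\<epsilon>. 0 < \<epsilon> \<Longrightarrow> \<forall>\<^sub>F n in sequentially. \<forall>x\<in>topspace X. dist (h n x i) (G x) < \<epsilon>"
    proof (rule Met_TC.continuous_map_uniformly_Cauchy_limit[where X = X and f = "\<lambda>n x. h n x i"])
      show "\<forall>\<^sub>F n in sequentially. continuous_map X Met_TC.mtopology (\<lambda>x. h n x i)"
        using continuous_map_into_cube_coordinate[OF h(1) i] by simp
      fix \<epsilon> :: real assume "\<epsilon> > 0"
      then obtain N where N: "\<And>n. n \<ge> N \<Longrightarrow> \<delta> n < \<epsilon> / 2"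
        using order_tendstoD(2)[OF \<delta>_lim, of "\<epsilon> / 2"] by (auto simp: eventually_sequentially)
      define M where "M = max N (Suc k)"
      have "\<bar>h m x i - h M x i\<bar> < \<epsilon> / 2" if "M \<le> m" "x \<in> topspace X" for m x
      proof -
        have "i \<in> E M" using E_mono[of "Suc k" M] iE by (auto simp: M_def)
        then show ?thesis
          using telescope[OF that, of i] N[of M] \<delta>_pos[of m] by (simp add: M_def)
      qed
      then have "dist (h m x i) (h n x i) < \<epsilon>" if "M \<le> m" "M \<le> n" "x \<in> topspace X" for m n x
        using that unfolding dist_real_def by (smt (verit) field_sum_of_halves)
      then show "\<exists>N. \<forall>m n x. N \<le> m \<longrightarrow> N \<le> n \<longrightarrow> x \<in> topspace X \<longrightarrow> dist (h m x i) (h n x i) < \<epsilon>"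
        by blast
    qed (simp_all add: mcomplete_iff_complete complete_UNIV)
    moreover have "(\<lambda>n. h n x i) \<longlonglongrightarrow> G x" if "x \<in> topspace X" for x
      unfolding tendsto_iff
    proof (intro allI impI)
      fix \<epsilon> :: real assume "\<epsilon> > 0"
      from G[OF this] show "\<forall>\<^sub>F n in sequentially. dist (h n x i) (G x) < \<epsilon>"
        by (rule eventually_mono) (use that in blast)
    qed
    ultimately show ?thesis by auto
  qed
  then obtain G where G: "\<And>i. i \<in> Field \<tau> \<Longrightarrow> continuous_map X euclideanreal (G i)"
    "\<And>i x. i \<in> Field \<tau> \<Longrightarrow> x \<in> topspace X \<Longrightarrow> (\<lambda>n. h n x i) \<longlonglongrightarrow> G i x"
    by metis
  define g where "g x = (\<lambda>i\<in>Field \<tau>. G i x)" for x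
  have near: "\<bar>g x i - h n x i\<bar> \<le> \<delta> n" if "x \<in> topspace X" "i \<in> E n" for x i n
  proof -
    have i: "i \<in> Field \<tau>" using that(2) \<open>\<And>n. E n \<subseteq> Field \<tau>\<close> by blast
    have "(\<lambda>m. \<bar>h m x i - h n x i\<bar>) \<longlonglongrightarrow> \<bar>G i x - h n x i\<bar>"
      by (intro tendsto_intros G(2) i that)
    moreover have "\<bar>h m x i - h n x i\<bar> \<le> \<delta> n" if "m \<ge> n" for m
      using telescope[OF that \<open>x \<in> topspace X\<close> \<open>i \<in> E n\<close>] \<delta>_pos[of m] by linarith
    ultimately have "\<bar>G i x - h n x i\<bar> \<le> \<delta> n"
      by (intro LIMSEQ_le_const2 exI[of _ n]) auto
    then show ?thesis using i by (simp add: g_def)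
  qed
  show thesis
  proof (rule that[of g])
    show "continuous_map X ?Q g"
    proof (rule continuous_map_into_cubeI)
      fix x assume x: "x \<in> topspace X"
      have "0 \<le> G i x \<and> G i x \<le> 1" if i: "i \<in> Field \<tau>" for i
        using cube_coordinate_bounds[OF continuous_map_into_cube_mem[OF h(1) x] i]
        by (auto intro!: LIMSEQ_le_const[OF G(2)[OF i x]] LIMSEQ_le_const2[OF G(2)[OF i x]])
      then show "g x \<in> topspace ?Q"
        by (simp add: g_def topspace_Tychonov_cube)
    next
      fix i assume "i \<in> Field \<tau>"
      then show "continuous_map X euclideanreal (\<lambda>x. g x i)"
        using G(1) by (simp add: g_def)
    qed
    show "g y = f y" if y: "y \<in> Y" for y
    proof -
      have yX: "y \<in> topspace X" using y YX by blast
      have "G i y = f y i" if i: "i \<in> Field \<tau>" for i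
        using G(2)[OF i yX] h(2)[OF y] by (simp add: LIMSEQ_const_iff)
      then show ?thesis
        using continuous_map_into_cube_mem[OF f yX]
        by (auto simp: g_def topspace_Tychonov_cube PiE_iff extensional_def fun_eq_iff)
    qed
    show "g x \<notin> Z" if x: "x \<in> L n" for n x
      using away[OF x, of "g x"] near[of x _ "Suc n"] LX x by fastforce
  qed
qed

section \<open>Uncountable weight\<close>

text \<open>
  Recursion on \<open>\<alpha>\<close>: the coordinates in the finite sets \<open>E \<beta>\<close> chosen before stage \<open>\<alpha>\<close> number fewer than
  \<open>\<tau>\<close>, so a move \<open>r \<alpha>\<close> off \<open>Z\<close> can keep all of them. Compactness of its image yields a finite \<open>E \<alpha>\<close> which
  witnesses the avoidance. Including \<open>\<alpha>\<close> itself makes the sets \<open>E \<alpha>\<close> exhaust all coordinates.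
\<close>

lemma transfinite_rigid_moves:
  fixes \<tau> :: "'i rel" and Z :: "('i \<Rightarrow> real) set"
  assumes \<tau>: "Card_order \<tau>" "natLeq <o \<tau>" and Z: "Z_tau_set \<tau> (Tychonov_cube \<tau>) Z"
  obtains E :: "'i \<Rightarrow> 'i set" and r :: "'i \<Rightarrow> ('i \<Rightarrow> real) \<Rightarrow> 'i \<Rightarrow> real" where
    "\<And>\<alpha>. \<alpha> \<in> Field \<tau> \<Longrightarrow> E \<alpha> \<subseteq> Field \<tau>" "\<And>\<alpha>. \<alpha> \<in> Field \<tau> \<Longrightarrow> \<alpha> \<in> E \<alpha>"
    "\<And>\<alpha>. \<alpha> \<in> Field \<tau> \<Longrightarrow> continuous_map (Tychonov_cube \<tau>) (Tychonov_cube \<tau>) (r \<alpha>)"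
    "\<And>\<alpha> y z. \<alpha> \<in> Field \<tau> \<Longrightarrow> y \<in> topspace (Tychonov_cube \<tau>) \<Longrightarrow> z \<in> Z \<Longrightarrow> \<exists>i\<in>E \<alpha>. r \<alpha> y i \<noteq> z i"
    "\<And>\<alpha> \<beta> y i. \<alpha> \<in> Field \<tau> \<Longrightarrow> y \<in> topspace (Tychonov_cube \<tau>) \<Longrightarrow> \<beta> \<in> underS \<tau> \<alpha> \<Longrightarrow>
      i \<in> E \<beta> \<Longrightarrow> r \<alpha> y i = y i"
proof -
  let ?Q = "Tychonov_cube \<tau>"
  have "Well_order \<tau>" using \<tau>(1) by (rule card_order_on_well_order_on)
  then have wf: "wf (\<tau> - Id)" by (simp add: well_order_on_def)
  have underS_Field: "\<beta> \<in> Field \<tau>" if "\<beta> \<in> underS \<tau> \<alpha>" for \<alpha> \<beta>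
    using that by (auto simp: underS_def Field_def)
  define P where "P = (\<lambda>(s :: 'i \<Rightarrow> 'i set \<times> (('i \<Rightarrow> real) \<Rightarrow> 'i \<Rightarrow> real)) \<alpha> p.
    \<alpha> \<in> Field \<tau> \<longrightarrow> finite (fst p) \<and> fst p \<subseteq> Field \<tau> \<and> \<alpha> \<in> fst p \<and>
    continuous_map ?Q ?Q (snd p) \<and>
    (\<forall>y\<in>topspace ?Q. \<forall>z\<in>Z. \<exists>i\<in>fst p. snd p y i \<noteq> z i) \<and>
    (\<forall>y\<in>topspace ?Q. \<forall>\<beta>\<in>underS \<tau> \<alpha>. \<forall>i\<in>fst (s \<beta>). snd p y i = y i))"
  have "\<exists>s. \<forall>\<alpha>. P s \<alpha> (s \<alpha>)"
  proof (rule dependent_wf_choice[OF wf])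
    fix s s' :: "'i \<Rightarrow> 'i set \<times> (('i \<Rightarrow> real) \<Rightarrow> 'i \<Rightarrow> real)" and \<alpha> p
    assume "\<And>\<beta>. (\<beta>, \<alpha>) \<in> \<tau> - Id \<Longrightarrow> s \<beta> = s' \<beta>"
    then have "\<And>\<beta>. \<beta> \<in> underS \<tau> \<alpha> \<Longrightarrow> s \<beta> = s' \<beta>" by (auto simp: underS_def)
    then show "P s \<alpha> p = P s' \<alpha> p" by (simp add: P_def)
  next
    fix s :: "'i \<Rightarrow> 'i set \<times> (('i \<Rightarrow> real) \<Rightarrow> 'i \<Rightarrow> real)" and \<alpha>
    assume IH: "\<And>\<beta>. (\<beta>, \<alpha>) \<in> \<tau> - Id \<Longrightarrow> P s \<beta> (s \<beta>)"
    show "\<exists>p. P s \<alpha> p"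
    proof (cases "\<alpha> \<in> Field \<tau>")
      case \<alpha>: True
      define F where "F = (\<Union>\<beta>\<in>underS \<tau> \<alpha>. fst (s \<beta>))"
      have s: "finite (fst (s \<beta>)) \<and> fst (s \<beta>) \<subseteq> Field \<tau>" if "\<beta> \<in> underS \<tau> \<alpha>" for \<beta>
        using IH[of \<beta>] underS_Field[OF that] that by (auto simp: P_def underS_def)
      have "|F| <o \<tau>"
        unfolding F_def
        by (rule card_UN_countable_less[OF \<tau> card_of_underS[OF \<tau>(1) \<alpha>]]) (use s countable_finite in blast)
      moreover have "F \<subseteq> Field \<tau>" using s by (auto simp: F_def)
      ultimately obtain r where r: "continuous_map ?Q ?Q r" "r ` topspace ?Q \<inter> Z = {}"
        "\<And>y i. y \<in> topspace ?Q \<Longrightarrow> i \<in> F \<Longrightarrow> r y i = y i"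
        using rigid_move_off_Z_tau_set[OF \<tau> Z] by blast
      have "closedin ?Q Z" using Z by (simp add: Z_tau_set_def)
      moreover have "compactin ?Q (r ` topspace ?Q)"
        using compact_space_Tychonov_cube r(1) by (auto simp: compact_space_def intro: image_compactin)
      ultimately obtain D d where D: "finite D" "D \<subseteq> Field \<tau>" "d > (0::real)"
        "\<And>a z. a \<in> r ` topspace ?Q \<Longrightarrow> z \<in> Z \<Longrightarrow> \<exists>i\<in>D. \<bar>z i - a i\<bar> \<ge> d"
        using r(2) by (rule compact_closed_separated_in_cube) (rule that)
      have "\<exists>i\<in>insert \<alpha> D. r y i \<noteq> z i" if y: "y \<in> topspace ?Q" and z: "z \<in> Z" for y z
      proof -
        obtain i where "i \<in> D" "\<bar>z i - r y i\<bar> \<ge> d"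
          using D(4)[OF imageI[OF y] z] by blast
        then show ?thesis using D(3) by (intro bexI[of _ i]) auto
      qed
      then show ?thesis
        using D(1,2) \<alpha> r(1,3)
        by (intro exI[of _ "(insert \<alpha> D, r)"]) (simp add: P_def F_def, blast)
    qed (simp add: P_def)
  qed
  then obtain s where s: "\<And>\<alpha>. P s \<alpha> (s \<alpha>)" by blast
  show thesis
    by (rule that[of "\<lambda>\<alpha>. fst (s \<alpha>)" "\<lambda>\<alpha>. snd (s \<alpha>)"]) (use s in \<open>auto simp: P_def\<close>)
qed

text \<open>
  Every coordinate \<open>i\<close> is assigned at a single stage, the first \<open>\<rho> i\<close> with \<open>i \<in> E (\<rho> i)\<close>, and never changed
  afterwards; thus limit stages need no convergence argument. At stage \<open>\<alpha>\<close> the current map \<open>q h \<alpha>\<close>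
  consists of the coordinates assigned before, those in \<open>F \<alpha>\<close>, and of \<open>f\<close> elsewhere. The coordinates of
  \<open>E \<alpha>\<close> outside \<open>F \<alpha>\<close> are taken from the blend of \<open>f\<close> with \<open>r \<alpha>\<close> after \<open>q h \<alpha>\<close>. On \<open>L \<alpha>\<close> the final map then
  agrees with \<open>r \<alpha>\<close> after \<open>q h \<alpha>\<close> on all of \<open>E \<alpha>\<close>, in \<open>F \<alpha>\<close> because \<open>r \<alpha>\<close> keeps those coordinates, and
  \<open>E \<alpha>\<close> alone shows that the value is not in \<open>Z\<close>.
\<close>

lemma exists_avoiding_map_uncountable:
  fixes f :: "'a \<Rightarrow> 'i \<Rightarrow> real" and L :: "'i \<Rightarrow> 'a set"
  assumes \<tau>: "Card_order \<tau>" "natLeq <o \<tau>" and Z: "Z_tau_set \<tau> (Tychonov_cube \<tau>) Z"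
    and X: "compactum X" "closedin X Y" and f: "continuous_map X (Tychonov_cube \<tau>) f"
    and L: "\<And>\<alpha>. \<alpha> \<in> Field \<tau> \<Longrightarrow> compactin X (L \<alpha>)" "\<And>\<alpha>. \<alpha> \<in> Field \<tau> \<Longrightarrow> L \<alpha> \<inter> Y = {}"
  obtains g where "continuous_map X (Tychonov_cube \<tau>) g" "\<And>y. y \<in> Y \<Longrightarrow> g y = f y"
    "\<And>\<alpha> x. \<alpha> \<in> Field \<tau> \<Longrightarrow> x \<in> L \<alpha> \<Longrightarrow> g x \<notin> Z"
proof -
  let ?Q = "Tychonov_cube \<tau>"
  have YX: "Y \<subseteq> topspace X" using X(2) by (rule closedin_subset)
  have wo: "Well_order \<tau>" using \<tau>(1) by (rule card_order_on_well_order_on)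
  then have wf: "wf (\<tau> - Id)" and trans: "trans \<tau>"
    and total: "\<And>\<alpha> \<beta>. \<alpha> \<in> Field \<tau> \<Longrightarrow> \<beta> \<in> Field \<tau> \<Longrightarrow> (\<alpha>, \<beta>) \<in> \<tau> \<or> (\<beta>, \<alpha>) \<in> \<tau>"
    by (auto simp: order_on_defs total_on_def refl_on_def) metis
  have underS_Field: "\<beta> \<in> Field \<tau>" if "\<beta> \<in> underS \<tau> \<alpha>" for \<alpha> \<beta>
    using that by (auto simp: underS_def Field_def)
  have fQ: "f x \<in> topspace ?Q" if "x \<in> topspace X" for x
    using f that by (rule continuous_map_into_cube_mem)

  obtain E r where E: "\<And>\<alpha>. \<alpha> \<in> Field \<tau> \<Longrightarrow> E \<alpha> \<subseteq> Field \<tau>" "\<And>\<alpha>. \<alpha> \<in> Field \<tau> \<Longrightarrow> \<alpha> \<in> E \<alpha>"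
    and r: "\<And>\<alpha>. \<alpha> \<in> Field \<tau> \<Longrightarrow> continuous_map ?Q ?Q (r \<alpha>)"
    and r_off: "\<And>\<alpha> y z. \<alpha> \<in> Field \<tau> \<Longrightarrow> y \<in> topspace ?Q \<Longrightarrow> z \<in> Z \<Longrightarrow> \<exists>i\<in>E \<alpha>. r \<alpha> y i \<noteq> z i"
    and r_id: "\<And>\<alpha> \<beta> y i. \<alpha> \<in> Field \<tau> \<Longrightarrow> y \<in> topspace ?Q \<Longrightarrow> \<beta> \<in> underS \<tau> \<alpha> \<Longrightarrow> i \<in> E \<beta> \<Longrightarrow> r \<alpha> y i = y i"
    by (rule transfinite_rigid_moves[OF \<tau> Z]) (rule that)
  define F where "F \<alpha> = (\<Union>\<beta>\<in>underS \<tau> \<alpha>. E \<beta>)" for \<alpha>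
  have r_fix: "r \<alpha> y i = y i" if "\<alpha> \<in> Field \<tau>" "y \<in> topspace ?Q" "i \<in> F \<alpha>" for \<alpha> y i
    using r_id[OF that(1,2)] that(3) by (auto simp: F_def)
  have F_Field: "F \<alpha> \<subseteq> Field \<tau>" for \<alpha>
    using E(1) underS_Field by (auto simp: F_def)

  have "\<exists>\<alpha>. \<alpha> \<in> Field \<tau> \<and> i \<in> E \<alpha> \<and> i \<notin> F \<alpha>" if i: "i \<in> Field \<tau>" for i
  proof -
    obtain \<alpha> where \<alpha>: "\<alpha> \<in> {\<alpha> \<in> Field \<tau>. i \<in> E \<alpha>}"
      "\<And>\<beta>. (\<beta>, \<alpha>) \<in> \<tau> - Id \<Longrightarrow> \<beta> \<notin> {\<alpha> \<in> Field \<tau>. i \<in> E \<alpha>}"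
      using wfE_min[OF wf, of i "{\<alpha> \<in> Field \<tau>. i \<in> E \<alpha>}"] i E(2) by blast
    then have "i \<notin> F \<alpha>"
      using underS_Field[of _ \<alpha>] by (auto simp: F_def underS_def)
    then show ?thesis using \<alpha>(1) by blast
  qed
  then obtain \<rho> where \<rho>: "\<And>i. i \<in> Field \<tau> \<Longrightarrow> \<rho> i \<in> Field \<tau>" "\<And>i. i \<in> Field \<tau> \<Longrightarrow> i \<in> E (\<rho> i)"
    "\<And>i. i \<in> Field \<tau> \<Longrightarrow> i \<notin> F (\<rho> i)"
    by metis
  have \<rho>_le: "(\<rho> i, \<alpha>) \<in> \<tau>" if "\<alpha> \<in> Field \<tau>" "i \<in> E \<alpha>" for \<alpha> i
  proof -
    have i: "i \<in> Field \<tau>" using E(1) that by blast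
    then have "\<alpha> \<notin> underS \<tau> (\<rho> i)" using \<rho>(3) that(2) by (auto simp: F_def)
    then show ?thesis
      using total[OF that(1) \<rho>(1)[OF i]] total[OF that(1,1)] by (auto simp: underS_def)
  qed
  have \<rho>_eq: "\<rho> i = \<alpha>" if "\<alpha> \<in> Field \<tau>" "i \<in> E \<alpha>" "i \<notin> F \<alpha>" for \<alpha> i
  proof (rule ccontr)
    assume "\<rho> i \<noteq> \<alpha>"
    then have "\<rho> i \<in> underS \<tau> \<alpha>" using \<rho>_le[OF that(1,2)] by (simp add: underS_def)
    moreover have "i \<in> E (\<rho> i)" using \<rho>(2) E(1) that by blast
    ultimately show False using that(3) by (auto simp: F_def)
  qed
  have \<rho>_less: "(\<rho> j, \<rho> i) \<in> \<tau> - Id" if i: "i \<in> Field \<tau>" and j: "j \<in> F (\<rho> i)" for i j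
  proof -
    obtain \<beta> where \<beta>: "\<beta> \<in> underS \<tau> (\<rho> i)" "j \<in> E \<beta>" using j by (auto simp: F_def)
    have "(\<rho> j, \<beta>) \<in> \<tau>" using \<rho>_le underS_Field \<beta> by blast
    moreover have "(\<beta>, \<rho> i) \<in> \<tau>" using \<beta>(1) by (simp add: underS_def)
    ultimately have "(\<rho> j, \<rho> i) \<in> \<tau>" using trans by (meson transD)
    moreover have "\<rho> j \<noteq> \<rho> i" using \<rho>(3)[of j] j F_Field[of "\<rho> i"] by auto
    ultimately show ?thesis by simp
  qed
  \<comment> \<open>Coordinate \<open>i\<close> depends on the coordinates assigned at stages before \<open>\<rho> i\<close>.\<close>
  define R where "R = {(j, i). i \<in> Field \<tau> \<and> j \<in> F (\<rho> i)}"
  have wf_R: "wf R"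
    by (rule wf_subset[OF wf_inv_image[OF wf, of \<rho>]]) (use \<rho>_less in \<open>auto simp: R_def\<close>)

  have "\<exists>\<phi>. continuous_map X euclideanreal \<phi> \<and> (\<forall>x\<in>topspace X. 0 \<le> \<phi> x \<and> \<phi> x \<le> 1) \<and>
      (\<forall>x\<in>Y. \<phi> x = 0) \<and> (\<forall>x\<in>L \<alpha>. \<phi> x = (1::real))" if "\<alpha> \<in> Field \<tau>" for \<alpha>
    using Urysohn_compactum[OF X L(1)[OF that] L(2)[OF that]] by metis
  then have "\<forall>\<alpha>\<in>Field \<tau>. \<exists>\<phi>. continuous_map X euclideanreal \<phi> \<and>
      (\<forall>x\<in>topspace X. 0 \<le> \<phi> x \<and> \<phi> x \<le> 1) \<and> (\<forall>x\<in>Y. \<phi> x = 0) \<and> (\<forall>x\<in>L \<alpha>. \<phi> x = (1::real))"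
    by (rule ballI)
  from bchoice[OF this] obtain \<phi> :: "'i \<Rightarrow> 'a \<Rightarrow> real" where
    "\<forall>\<alpha>\<in>Field \<tau>. continuous_map X euclideanreal (\<phi> \<alpha>) \<and>
      (\<forall>x\<in>topspace X. 0 \<le> \<phi> \<alpha> x \<and> \<phi> \<alpha> x \<le> 1) \<and> (\<forall>x\<in>Y. \<phi> \<alpha> x = 0) \<and> (\<forall>x\<in>L \<alpha>. \<phi> \<alpha> x = 1)"
    by (elim exE) (rule that)
  then have \<phi>: "\<And>\<alpha>. \<alpha> \<in> Field \<tau> \<Longrightarrow> continuous_map X euclideanreal (\<phi> \<alpha>)"
    "\<And>\<alpha> x. \<alpha> \<in> Field \<tau> \<Longrightarrow> x \<in> topspace X \<Longrightarrow> 0 \<le> \<phi> \<alpha> x \<and> \<phi> \<alpha> x \<le> 1"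
    "\<And>\<alpha> x. \<alpha> \<in> Field \<tau> \<Longrightarrow> x \<in> Y \<Longrightarrow> \<phi> \<alpha> x = 0" "\<And>\<alpha> x. \<alpha> \<in> Field \<tau> \<Longrightarrow> x \<in> L \<alpha> \<Longrightarrow> \<phi> \<alpha> x = 1"
    by blast+

  define q where "q h \<alpha> x = (\<lambda>j\<in>Field \<tau>. if j \<in> F \<alpha> then h j x else f x j)"
    for h :: "'i \<Rightarrow> 'a \<Rightarrow> real" and \<alpha> x
  define T where "T h i x = (1 - \<phi> (\<rho> i) x) * f x i + \<phi> (\<rho> i) x * r (\<rho> i) (q h (\<rho> i) x) i"
    for h i x
  have "\<exists>h. \<forall>i. i \<in> Field \<tau> \<longrightarrow> h i = T h i"
  proof (rule dependent_wf_choice[OF wf_R])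
    fix h h' :: "'i \<Rightarrow> 'a \<Rightarrow> real" and i v
    assume eq: "\<And>j. (j, i) \<in> R \<Longrightarrow> h j = h' j"
    have "q h (\<rho> i) = q h' (\<rho> i)" if "i \<in> Field \<tau>"
      using eq that by (auto simp: q_def R_def fun_eq_iff restrict_def)
    then have "T h i = T h' i" if "i \<in> Field \<tau>"
      using that by (intro ext) (simp add: T_def)
    then show "(i \<in> Field \<tau> \<longrightarrow> v = T h i) = (i \<in> Field \<tau> \<longrightarrow> v = T h' i)"
      by auto
  qed blast
  then obtain h where h: "\<And>i. i \<in> Field \<tau> \<Longrightarrow> h i = T h i" by blast

  define good where "good i \<longleftrightarrow>
    continuous_map X euclideanreal (h i) \<and> (\<forall>x\<in>topspace X. h i x \<in> {0..1})" for i
  have q_cont: "continuous_map X ?Q (q h \<alpha>)" if "\<And>j. j \<in> F \<alpha> \<Longrightarrow> good j" for \<alpha>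
  proof (rule continuous_map_into_cubeI)
    fix x assume "x \<in> topspace X"
    then show "q h \<alpha> x \<in> topspace ?Q"
      using that cube_coordinate_bounds[OF fQ] by (auto simp: q_def topspace_Tychonov_cube good_def)
  next
    fix j assume j: "j \<in> Field \<tau>"
    show "continuous_map X euclideanreal (\<lambda>x. q h \<alpha> x j)"
      using j that[of j] continuous_map_into_cube_coordinate[OF f j]
      by (cases "j \<in> F \<alpha>") (simp_all add: q_def good_def)
  qed
  have good: "i \<in> Field \<tau> \<longrightarrow> good i" for i
    using wf_R
  proof (induction i rule: wf_induct_rule)
    case (less i)
    show ?case
    proof
      assume i: "i \<in> Field \<tau>"
      have "continuous_map X ?Q (q h (\<rho> i))"
        using less i F_Field by (intro q_cont) (auto simp: R_def)
      then have "continuous_map X ?Q (\<lambda>x. r (\<rho> i) (q h (\<rho> i) x))"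
        using continuous_map_compose[OF _ r[OF \<rho>(1)[OF i]]] by (fastforce simp: o_def)
      then have mix: "continuous_map X ?Q (\<lambda>x. \<lambda>j\<in>Field \<tau>.
          (1 - \<phi> (\<rho> i) x) * f x j + \<phi> (\<rho> i) x * r (\<rho> i) (q h (\<rho> i) x) j)" (is "continuous_map X ?Q ?m")
        by (rule continuous_map_into_cube_mix[OF f _ \<phi>(1,2)[OF \<rho>(1)[OF i]]])
      have "h i x = ?m x i" for x
        using i h[OF i] by (simp add: T_def)
      then have "h i = (\<lambda>x. ?m x i)" by blast
      then show "good i"
        using continuous_map_into_cube_coordinate[OF mix i]
          cube_coordinate_bounds[OF continuous_map_into_cube_mem[OF mix] i]
        unfolding good_def by (metis atLeastAtMost_iff)
    qed
  qed
  define g where "g x = (\<lambda>i\<in>Field \<tau>. h i x)" for x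
  have qQ: "q h \<alpha> x \<in> topspace ?Q" if "x \<in> topspace X" for \<alpha> x
    using good F_Field q_cont[of \<alpha>] that by (blast intro: continuous_map_into_cube_mem)
  show thesis
  proof (rule that[of g])
    show "continuous_map X ?Q g"
      using good by (intro continuous_map_into_cubeI)
        (simp_all add: g_def good_def topspace_Tychonov_cube)
    show "g y = f y" if "y \<in> Y" for y
      using fQ[of y] that YX \<phi>(3) \<rho>(1) h
      by (auto simp: g_def T_def topspace_Tychonov_cube PiE_iff extensional_def fun_eq_iff)
    show "g x \<notin> Z" if \<alpha>: "\<alpha> \<in> Field \<tau>" and x: "x \<in> L \<alpha>" for \<alpha> x
    proof
      assume "g x \<in> Z"
      have xX: "x \<in> topspace X" using compactin_subset_topspace[OF L(1)[OF \<alpha>]] x by blast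
      obtain i where i: "i \<in> E \<alpha>" "r \<alpha> (q h \<alpha> x) i \<noteq> g x i"
        using r_off[OF \<alpha> qQ[OF xX] \<open>g x \<in> Z\<close>] by blast
      have iF: "i \<in> Field \<tau>" using i(1) E(1)[OF \<alpha>] by blast
      show False
      proof (cases "i \<in> F \<alpha>")
        case True
        then show False
          using r_fix[OF \<alpha> qQ[OF xX] True] iF i(2) by (simp add: q_def g_def)
      next
        case False
        then have "\<rho> i = \<alpha>" using \<rho>_eq[OF \<alpha> i(1)] by blast
        then have "h i x = r \<alpha> (q h \<alpha> x) i"
          using h[OF iF] \<phi>(4)[OF \<alpha> x] by (simp add: T_def)
        then show False using i(2) iF by (simp add: g_def)
      qed
    qed
  qed
qed

section \<open>Avoiding the \<open>Z\<^sub>\<tau>\<close>-set on all compact sets\<close>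

theorem proposition3p9:
  fixes \<tau> :: "'i rel" and Z :: "('i \<Rightarrow> real) set"
    and X :: "'a topology" and Y :: "'a set"
    and f :: "'a \<Rightarrow> 'i \<Rightarrow> real" and K :: "'i \<Rightarrow> 'a set"
  assumes "Card_order \<tau>" and "natLeq \<le>o \<tau>"
    and "Z_tau_set \<tau> (Tychonov_cube \<tau>) Z"
    and "compactum X" and "closedin X Y"
    and "continuous_map X (Tychonov_cube \<tau>) f"
    and "\<forall>\<alpha>\<in>nonzero_ordinals_below \<tau>. compactin X (K \<alpha>)"
    and "(\<Union>\<alpha>\<in>nonzero_ordinals_below \<tau>. K \<alpha>) \<inter> Y = {}"
  shows "\<exists>g. continuous_map X (Tychonov_cube \<tau>) g \<and> (\<forall>y\<in>Y. g y = f y) \<and>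
           g ` (\<Union>\<alpha>\<in>nonzero_ordinals_below \<tau>. K \<alpha>) \<subseteq> topspace (Tychonov_cube \<tau>) - Z"
proof -
  let ?Q = "Tychonov_cube \<tau>" and ?A = "nonzero_ordinals_below \<tau>"
  \<comment> \<open>The index 0 carries the empty set, so that the stages run through the whole field of \<open>\<tau>\<close>.\<close>
  define L where "L \<alpha> = (if \<alpha> \<in> ?A then K \<alpha> else {})" for \<alpha>
  have L: "compactin X (L \<alpha>)" "L \<alpha> \<inter> Y = {}" for \<alpha>
    using assms(7,8) by (auto simp: L_def)
  have "\<exists>g. continuous_map X ?Q g \<and> (\<forall>y\<in>Y. g y = f y) \<and> (\<forall>\<alpha>\<in>Field \<tau>. \<forall>x\<in>L \<alpha>. g x \<notin> Z)"
  proof (cases "natLeq <o \<tau>")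
    case True
    then show ?thesis
      using exists_avoiding_map_uncountable[OF assms(1) True assms(3-6), of L] L by metis
  next
    case False
    then have "\<tau> \<le>o natLeq"
      using assms(1) natLeq_Well_order by (meson card_order_on_well_order_on not_ordLess_iff_ordLeq)
    then have "|Field \<tau>| \<le>o |UNIV :: nat set|"
      using card_of_mono2[of \<tau> natLeq] by (simp add: Field_natLeq)
    then have "countable (Field \<tau>)"
      by (auto simp: countable_def simp flip: card_of_ordLeq)
    moreover have "Field \<tau> \<noteq> {}"
      using infinite_Field_if_natLeq_ordLeq[OF assms(2)] by auto
    ultimately obtain e :: "nat \<Rightarrow> 'i" where e: "range e = Field \<tau>"
      using range_from_nat_into by metis
    have "\<exists>g. continuous_map X ?Q g \<and> (\<forall>y\<in>Y. g y = f y) \<and> (\<forall>n. \<forall>x\<in>L (e n). g x \<notin> Z)"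
      using exists_avoiding_map_countable[OF assms(1-6), of "\<lambda>n. L (e n)" e] L e by metis
    then show ?thesis by (metis e rangeE)
  qed
  then obtain g where g: "continuous_map X ?Q g" "\<forall>y\<in>Y. g y = f y"
    "\<And>\<alpha> x. \<alpha> \<in> Field \<tau> \<Longrightarrow> x \<in> L \<alpha> \<Longrightarrow> g x \<notin> Z"
    by blast
  have "g x \<in> topspace ?Q - Z" if "\<alpha> \<in> ?A" "x \<in> K \<alpha>" for \<alpha> x
  proof -
    have "x \<in> topspace X" using compactin_subset_topspace[of X "K \<alpha>"] assms(7) that by blast
    moreover have "\<alpha> \<in> Field \<tau>" using that(1) by (simp add: nonzero_ordinals_below_def)
    ultimately show ?thesis
      using continuous_map_into_cube_mem[OF g(1)] g(3)[of \<alpha> x] that by (simp add: L_def)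
  qed
  then show ?thesis using g(1,2) by (intro exI[of _ g]) auto
qed

end
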